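(* Let $c,b\ge2$ be integers, put $\alpha=\log_b c$, and suppose that $q\alpha-p=\varepsilon>0$ with $q\in\mathbb Z_{\ge1}$, $p\in\mathbb Z$. Define $\varrho=c^q/b^p=b^\varepsilon>1$, $x=q/(\varrho-1)$, $M=\lfloor x\rfloor$, and assume $M\ge1$. For $j\ge0$, put $$n_j=M+jq,\qquad \mathcal I_j=\left[\frac{n_j}{\varrho^j},\frac{n_j+1}{\varrho^j}\right).$$ For every integer $J\ge1$, the intersection $\bigcap_{j=0}^{J}\mathcal I_j$ equals $$\left[\frac{M+q}{\varrho},\frac{M+Jq+1}{\varrho^J}\right)\quad\text{if }\varrho^{J-1}(M+q)<M+Jq+1,$$ and is empty if $\varrho^{J-1}(M+q)\ge M+Jq+1$. Consequently, $$J_{\max}=\max\left\{J\ge1:\varrho^{J-1}(M+q)<M+Jq+1\right\}$$ is well defined and finite. For every $K\in\mathbb Z$ and $j\ge0$, $$(M+jq)b^{K+jp}\le c^{M+jq}<(M+jq+1)b^{K+jp}\quad\Longleftrightarrow\quad\frac{c^M}{b^K}\in\mathcal I_j.$$ If $1\le J\le J_{\max}$ and both $M+q$ and $M+Jq$ belong to $\mathcal S_{c,b}$, then $$M,M+q,M+2q,\ldots,M+Jq\in\mathcal S_{c,b}.$$ Moreover, their unique radix scales form an arithmetic progression $K,K+p,K+2p,\ldots,K+Jp$ for some $K\ge0$.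
   Context: $\mathcal S_{c,b}$ is the set of integers $m\ge1$ for which there is an integer $k\ge0$ with $mb^k\le c^m<(m+1)b^k$; for $m\in\mathcal S_{c,b}$ this $k$ is unique and is called the radix scale of $m$. *)

theory Defs
  imports Complex_Main
begin

definition is_radix_scale :: "nat \<Rightarrow> nat \<Rightarrow> nat \<Rightarrow> nat \<Rightarrow> bool" where
  "is_radix_scale c b m k \<longleftrightarrow> m * b ^ k \<le> c ^ m \<and> c ^ m < (m + 1) * b ^ k"

definition radix_set :: "nat \<Rightarrow> nat \<Rightarrow> nat set" where
  "radix_set c b = {m. m \<ge> 1 \<and> (\<exists>k. is_radix_scale c b m k)}"

text \<open>Meaningful for \<open>b \<ge> 2\<close> and \<open>m \<in> radix_set c b\<close>, where the scale exists and is
  unique (lemma \<open>ex1_radix_scale\<close> below).\<close>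

definition radix_scale :: "nat \<Rightarrow> nat \<Rightarrow> nat \<Rightarrow> nat" where
  "radix_scale c b m = (THE k. is_radix_scale c b m k)"

lemma is_radix_scale_not_less:
  assumes "b \<ge> 2" "m \<ge> 1" "is_radix_scale c b m k" "is_radix_scale c b m l"
  shows "\<not> k < l"
proof
  assume "k < l"
  have "(m + 1) * b ^ k \<le> (m * b) * b ^ k"
  proof (rule mult_right_mono)
    have "m * 2 \<le> m * b" using assms(1) by simp
    then show "m + 1 \<le> m * b" using assms(2) by linarith
  qed simp
  also have "\<dots> = m * b ^ Suc k" by simp
  also have "\<dots> \<le> m * b ^ l"
    using \<open>k < l\<close> assms(1) by (intro mult_left_mono power_increasing) auto
  also have "\<dots> \<le> c ^ m" using assms(4) by (simp add: is_radix_scale_def)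
  also have "\<dots> < (m + 1) * b ^ k" using assms(3) by (simp add: is_radix_scale_def)
  finally show False by simp
qed

lemma ex1_radix_scale:
  assumes "b \<ge> 2" "m \<in> radix_set c b"
  shows "\<exists>!k. is_radix_scale c b m k"
proof -
  from assms(2) obtain k where m: "m \<ge> 1" and k: "is_radix_scale c b m k"
    by (auto simp: radix_set_def)
  show ?thesis
  proof (rule ex1I[of _ k])
    show "is_radix_scale c b m k" by (rule k)
  next
    fix l assume l: "is_radix_scale c b m l"
    show "l = k"
      using is_radix_scale_not_less[OF assms(1) m k l] is_radix_scale_not_less[OF assms(1) m l k]
      by simp
  qed
qed

lemma is_radix_scale_radix_scale:
  assumes "b \<ge> 2" "m \<in> radix_set c b"
  shows "is_radix_scale c b m (radix_scale c b m)"
  unfolding radix_scale_def by (rule theI'[OF ex1_radix_scale[OF assms]])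

end

theory Submission
  imports Defs
begin

text \<open>
  Write \<open>L\<^sub>j = (M + j q) / \<rho>\<^sup>j\<close> and \<open>R\<^sub>j = (M + j q + 1) / \<rho>\<^sup>j\<close> for the endpoints of the
  windows. Passing from \<open>j\<close> to \<open>j + 1\<close> adds \<open>q\<close> to the numerator and multiplies the denominator
  by \<open>\<rho>\<close>, so an endpoint with numerator \<open>a\<close> moves left exactly when \<open>a\<close> lies above the fixed point
  \<open>q / (\<rho> - 1)\<close> of \<open>a \<mapsto> \<rho> a - q\<close>. Since \<open>M\<close> is the floor of that fixed point,
  the right endpoints always decrease, whereas \<open>L\<^sub>0 \<le> L\<^sub>1\<close> and the left endpoints decrease
  only from \<open>L\<^sub>1\<close> on. Hence the windows \<open>0, \<dots>, J\<close> meet in \<open>[L\<^sub>1, R\<^sub>J)\<close>, and a point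
  that lies in windows \<open>1\<close> and \<open>J\<close> lies in all windows between them and in window \<open>0\<close>
  (\<open>mem_first_last_imp_mem_all\<close>). The condition on \<open>J\<close> says \<open>L\<^sub>1 < R\<^sub>J\<close>; it fails for large
  \<open>J\<close> because \<open>R\<^sub>J\<close> tends to \<open>0\<close>.

  Dividing by \<open>b\<^sup>K\<^sup>+\<^sup>j\<^sup>p\<close> and using \<open>c\<^sup>q = \<rho> b\<^sup>p\<close> turns the inequalities saying that
  \<open>K + j p\<close> is a radix scale of \<open>M + j q\<close> into \<open>c\<^sup>M / b\<^sup>K \<in> I\<^sub>j\<close> (\<open>scale_ineqs_iff_window\<close>).
  Therefore scales at \<open>M + q\<close> and \<open>M + J q\<close> give points \<open>c\<^sup>M / b\<^sup>K\<close> and \<open>c\<^sup>M / b\<^sup>K\<^sup>'\<close> in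
  windows \<open>1\<close> and \<open>J\<close>. If \<open>L\<^sub>1 < R\<^sub>J\<close>, these two windows together span a ratio of less than
  \<open>2 \<le> b\<close> (\<open>first_last_ratio\<close>), which forces \<open>K = K'\<close>. The single point \<open>c\<^sup>M / b\<^sup>K\<close>
  then lies in every window, so \<open>K + j p\<close> is a scale of \<open>M + j q\<close> for each \<open>j\<close>, provided that it is
  nonnegative; this is automatic because \<open>c\<^sup>m \<ge> m + 1\<close> (\<open>scale_nonneg\<close>).
\<close>

section \<open>Windows with linear numerators and geometric denominators\<close>

text \<open>The two inequalities on the drift \<open>q\<close> are a division-free form of
  \<open>M = \<lfloor>q / (\<rho> - 1)\<rfloor>\<close>.\<close>

locale drifting_windows =
  fixes \<rho> :: real and q M :: nat
  assumes rho_gt_1: "\<rho> > 1"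
    and q_pos: "q \<ge> 1"
    and M_pos: "M \<ge> 1"
    and drift_ge: "(\<rho> - 1) * real M \<le> real q"
    and drift_less: "real q < (\<rho> - 1) * (real M + 1)"
begin

definition lo :: "nat \<Rightarrow> real" where
  "lo j = real (M + j * q) / \<rho> ^ j"

definition hi :: "nat \<Rightarrow> real" where
  "hi j = (real (M + j * q) + 1) / \<rho> ^ j"

lemma drift_less_mult:
  assumes "real a \<ge> real M + 1"
  shows "real q < (\<rho> - 1) * real a"
proof -
  have "(\<rho> - 1) * (real M + 1) \<le> (\<rho> - 1) * real a"
    using assms rho_gt_1 by (intro mult_left_mono) auto
  with drift_less show ?thesis by linarith
qed

lemma add_drift_divide_le_iff:
  "(a + real q) / \<rho> ^ Suc j \<le> a / \<rho> ^ j \<longleftrightarrow> real q \<le> (\<rho> - 1) * a"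
proof -
  have "(a + real q) / \<rho> ^ Suc j \<le> a / \<rho> ^ j \<longleftrightarrow> (a + real q) / \<rho> / \<rho> ^ j \<le> a / \<rho> ^ j"
    by (simp add: mult.commute)
  also have "\<dots> \<longleftrightarrow> (a + real q) / \<rho> \<le> a"
    using rho_gt_1 by (intro divide_le_cancel[THEN trans]) auto
  also have "\<dots> \<longleftrightarrow> real q \<le> (\<rho> - 1) * a"
    using rho_gt_1 by (simp add: pos_divide_le_eq algebra_simps)
  finally show ?thesis .
qed

lemma hi_Suc_le: "hi (Suc j) \<le> hi j"
  using add_drift_divide_le_iff[of "real (M + j * q) + 1" j] drift_less_mult[of "M + j * q + 1"]
  by (simp add: hi_def algebra_simps)

lemma lo_Suc_le:
  assumes "j \<ge> 1"
  shows "lo (Suc j) \<le> lo j"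
proof -
  have "1 * 1 \<le> j * q" using assms q_pos by (intro mult_le_mono) auto
  then have "1 \<le> real j * real q" by (metis of_nat_1 of_nat_le_iff of_nat_mult mult_1)
  then show ?thesis
    using add_drift_divide_le_iff[of "real (M + j * q)" j] drift_less_mult[of "M + j * q"]
    by (simp add: lo_def algebra_simps)
qed

text \<open>Index \<open>0\<close> is the only one whose numerator does not exceed the fixed point of the drift,
  so this is the only step at which the left endpoint can move right.\<close>

lemma lo_0_le_lo_1: "lo 0 \<le> lo 1"
  using drift_ge rho_gt_1 by (simp add: lo_def pos_le_divide_eq algebra_simps)

lemma hi_antimono: "i \<le> j \<Longrightarrow> hi j \<le> hi i"
  by (rule lift_Suc_antimono_le[of hi, OF hi_Suc_le])

lemma lo_le_lo_1: "lo j \<le> lo 1"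
proof (induction j)
  case 0
  show ?case by (rule lo_0_le_lo_1)
next
  case (Suc j)
  then show ?case using lo_Suc_le[of j] by (cases "j = 0") auto
qed

lemma mem_first_last_imp_mem_all:
  assumes "y \<ge> lo 1" and "y < hi J" and "j \<le> J"
  shows "y \<in> {lo j..<hi j}"
  using assms lo_le_lo_1[of j] hi_antimono[of j J] by auto

lemma windows_Inter:
  assumes "J \<ge> 1"
  shows "(\<Inter>j\<in>{0..J}. {lo j..<hi j}) = {lo 1..<hi J}"
proof
  show "(\<Inter>j\<in>{0..J}. {lo j..<hi j}) \<subseteq> {lo 1..<hi J}"
    using assms by auto
  show "{lo 1..<hi J} \<subseteq> (\<Inter>j\<in>{0..J}. {lo j..<hi j})"
    using mem_first_last_imp_mem_all by auto
qed

lemma lo_1_less_hi_iff: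
  assumes "J \<ge> 1"
  shows "lo 1 < hi J \<longleftrightarrow> \<rho> ^ (J - 1) * real (M + q) < real (M + J * q + 1)"
proof -
  have "\<rho> ^ J = \<rho> * \<rho> ^ (J - 1)" using assms by (simp add: power_eq_if)
  then have "hi J = (real (M + J * q + 1) / \<rho> ^ (J - 1)) / \<rho>"
    by (simp add: hi_def ac_simps)
  then have "lo 1 < hi J \<longleftrightarrow> real (M + q) < real (M + J * q + 1) / \<rho> ^ (J - 1)"
    using divide_less_cancel[of "real (M + q)" \<rho> "real (M + J * q + 1) / \<rho> ^ (J - 1)"] rho_gt_1
    by (simp only: lo_def) simp
  then show ?thesis using rho_gt_1 by (simp add: pos_less_divide_eq mult.commute)
qed

lemma lo_1_less_hi_1: "lo 1 < hi 1"
  using rho_gt_1 by (simp add: lo_def hi_def divide_less_cancel)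

lemma hi_tendsto_0: "hi \<longlonglongrightarrow> 0"
proof -
  have r: "norm (1 / \<rho>) < 1" using rho_gt_1 by simp
  have "(\<lambda>j. (real M + 1) * (1 / \<rho>) ^ j + real q * (real j * (1 / \<rho>) ^ j))
      \<longlonglongrightarrow> (real M + 1) * 0 + real q * 0"
    by (intro tendsto_intros LIMSEQ_power_zero powser_times_n_limit_0 r)
  moreover have "(\<lambda>j. (real M + 1) * (1 / \<rho>) ^ j + real q * (real j * (1 / \<rho>) ^ j)) = hi"
    by (simp add: fun_eq_iff hi_def power_one_over add_divide_distrib algebra_simps)
  ultimately show ?thesis by simp
qed

lemma finite_lo_1_less_hi: "finite {J. lo 1 < hi J}"
proof -
  have "lo 1 > 0" using rho_gt_1 M_pos by (simp add: lo_def)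
  then have "eventually (\<lambda>J. hi J < lo 1) sequentially"
    using order_tendstoD(2)[OF hi_tendsto_0] by simp
  then obtain N where N: "\<And>J. J \<ge> N \<Longrightarrow> hi J < lo 1"
    by (auto simp: eventually_sequentially)
  have "{J. lo 1 < hi J} \<subseteq> {..<N}"
  proof
    fix J assume "J \<in> {J. lo 1 < hi J}"
    then show "J \<in> {..<N}" using N[of J] by (cases "J < N") auto
  qed
  then show ?thesis by (rule finite_subset) simp
qed

text \<open>For \<open>J \<ge> 2\<close>, put \<open>a = M + q \<ge> 2\<close> and \<open>d = M + J q \<ge> 3\<close>. The hypothesis \<open>lo 1 < hi J\<close> bounds
  \<open>\<rho>\<^sup>J\<^sup>-\<^sup>1\<close> by \<open>(d + 1) / a\<close>, so the quotient \<open>hi 1 / lo J\<close> is less than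
  \<open>((a + 1) / a) * ((d + 1) / d) \<le> (3 / 2) * (4 / 3) = 2\<close>.\<close>

lemma first_last_ratio:
  assumes "J \<ge> 1" and "lo 1 < hi J"
  shows "hi 1 < 2 * lo J"
proof (cases "J = 1")
  case True
  have "real M + real q > 1" using q_pos M_pos by linarith
  then show ?thesis using True rho_gt_1 by (simp add: lo_def hi_def divide_strict_right_mono)
next
  case False
  with assms(1) have "J \<ge> 2" by simp
  define a d where "a = real (M + q)" and "d = real (M + J * q)"
  define r where "r = \<rho> ^ (J - 1)"
  have "2 * q \<le> J * q" using \<open>J \<ge> 2\<close> by simp
  then have "M + J * q \<ge> 3" using q_pos M_pos by linarith
  then have d: "d \<ge> 3" unfolding d_def by linarith
  have "M + q \<ge> 2" using q_pos M_pos by linarith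
  then have a: "a \<ge> 2" unfolding a_def by linarith
  have ra: "r * a < d + 1"
    using assms lo_1_less_hi_iff[of J] by (simp add: r_def a_def d_def add_ac)
  have "(a + 1) * (r * a) < (a + 1) * (d + 1)"
    using ra a by (intro mult_strict_left_mono) auto
  also have "\<dots> \<le> 2 * d * a"
  proof -
    (* the difference of the two sides is (a - 2) * (d - 3) + 2 * (a - 2) + (d - 3) *)
    have "0 \<le> (a - 2) * (d - 3)" using a d by (intro mult_nonneg_nonneg) auto
    then show ?thesis using a d by (simp add: algebra_simps)
  qed
  finally have "((a + 1) * r) * a < (2 * d) * a" by (simp add: ac_simps)
  then have key: "(a + 1) * r < 2 * d" using a by (simp add: mult_less_cancel_right)
  have pow: "\<rho> ^ J = r * \<rho>" using assms(1) by (simp add: r_def power_eq_if)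
  have "r > 0" using rho_gt_1 by (simp add: r_def)
  then have "a + 1 < 2 * d / r" using key by (simp add: pos_less_divide_eq)
  then have "(a + 1) / \<rho> < 2 * d / r / \<rho>"
    using rho_gt_1 by (intro divide_strict_right_mono) auto
  then show ?thesis by (simp add: hi_def lo_def pow a_def d_def add_ac)
qed

end

section \<open>Radix scales as window memberships\<close>

lemma scale_ineqs_iff_window:
  fixes b c :: real and p K :: int
  assumes "b > 0" and "c > 0" and rho: "\<rho> = c ^ q / b powi p"
  shows "a * b powi (K + int j * p) \<le> c ^ (M + j * q)
           \<and> c ^ (M + j * q) < (a + 1) * b powi (K + int j * p)
         \<longleftrightarrow> c ^ M / b powi K \<in> {a / \<rho> ^ j..<(a + 1) / \<rho> ^ j}"
proof -
  define B where "B = b powi (int j * p)"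
  have B: "B > 0" and bK: "b powi K > 0" using assms by (simp_all add: B_def)
  have "\<rho> > 0" using assms by simp
  then have rho_j: "\<rho> ^ j > 0" by simp
  have "c ^ q = \<rho> * b powi p" using assms by simp
  then have "c ^ (j * q) = (\<rho> * b powi p) ^ j" by (metis power_mult mult.commute)
  also have "\<dots> = \<rho> ^ j * B"
    by (simp add: B_def power_mult_distrib power_int_mult mult.commute[of "int j"])
  finally have cpow: "c ^ (M + j * q) = c ^ M * \<rho> ^ j * B"
    by (simp add: power_add)
  have bpow: "b powi (K + int j * p) = b powi K * B"
    using assms by (simp add: B_def power_int_add)
  have "e * b powi (K + int j * p) \<le> c ^ (M + j * q)
      \<longleftrightarrow> e / \<rho> ^ j \<le> c ^ M / b powi K" for e
  proof -
    have "e * b powi (K + int j * p) \<le> c ^ (M + j * q)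
        \<longleftrightarrow> (e * b powi K) * B \<le> (c ^ M * \<rho> ^ j) * B"
      by (simp only: cpow bpow mult.assoc)
    also have "\<dots> \<longleftrightarrow> e * b powi K \<le> c ^ M * \<rho> ^ j"
      using B by (rule mult_le_cancel_right_pos)
    also have "\<dots> \<longleftrightarrow> e / \<rho> ^ j \<le> c ^ M / b powi K"
      using rho_j bK by (simp add: divide_simps)
    finally show ?thesis .
  qed
  from this[of a] this[of "a + 1"] show ?thesis by (auto simp: not_le[symmetric])
qed

lemma radix_scale_iff_powi:
  "is_radix_scale c b m k \<longleftrightarrow>
     real m * real b powi int k \<le> real c ^ m \<and> real c ^ m < (real m + 1) * real b powi int k"
proof -
  have "real m * real b powi int k = real (m * b ^ k)"
    and "(real m + 1) * real b powi int k = real ((m + 1) * b ^ k)"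
    by (simp_all add: algebra_simps)
  then show ?thesis
    by (simp only: is_radix_scale_def of_nat_power[symmetric] of_nat_le_iff of_nat_less_iff)
qed

text \<open>A negative exponent would bound \<open>c\<^sup>m\<close> by \<open>(m + 1) / b < m + 1\<close>,
  while \<open>c\<^sup>m \<ge> 2\<^sup>m \<ge> m + 1\<close>.\<close>

lemma scale_nonneg:
  fixes c b m :: nat and s :: int
  assumes "c \<ge> 2" and "b \<ge> 2" and "real c ^ m < (real m + 1) * real b powi s"
  shows "s \<ge> 0"
proof (rule ccontr)
  assume "\<not> s \<ge> 0"
  then have "real b powi s \<le> real b powi 0"
    using assms(2) by (intro power_int_increasing) auto
  then have "(real m + 1) * real b powi s \<le> (real m + 1) * 1"
    by (intro mult_left_mono) auto
  moreover have "m + 1 \<le> 2 ^ m" using less_exp[of m] by (simp add: Suc_le_eq)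
  then have "m + 1 \<le> c ^ m" using power_mono[OF assms(1), of m] by linarith
  then have "real m + 1 \<le> real c ^ m"
    by (metis of_nat_le_iff of_nat_power of_nat_Suc Suc_eq_plus1 add.commute)
  ultimately have "(real m + 1) * real b powi s \<le> real c ^ m" by (metis mult_1_right order_trans)
  with assms(3) show False by (simp add: not_le[symmetric])
qed

lemma exponent_unique_if_ratio_less_2:
  fixes b :: nat and t l :: real and K K' :: int
  assumes "b \<ge> 2"
    and "l \<le> t / real b powi K" and "t / real b powi K < 2 * l"
    and "l \<le> t / real b powi K'" and "t / real b powi K' < 2 * l"
  shows "K = K'"
proof -
  have False
    if "k < k'" and lower: "l \<le> t / real b powi k'" and upper: "t / real b powi k < 2 * l"
      and "l > 0" for k k' :: int
  proof -
    have "real b powi 1 \<le> real b powi (k' - k)"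
      using that assms(1) by (intro power_int_increasing) auto
    then have "2 \<le> real b powi (k' - k)" using assms(1) by simp
    then have "2 * l \<le> real b powi (k' - k) * (t / real b powi k')"
      using lower \<open>l > 0\<close> by (intro mult_mono) auto
    also have "\<dots> = t / real b powi k"
      using assms(1) by (simp add: power_int_diff)
    finally show False using upper by simp
  qed
  moreover have "l > 0" using assms(2,3) by linarith
  ultimately show ?thesis using assms(2-5) by (metis linorder_neqE)
qed

text \<open>Both scales locate \<open>c\<^sup>M\<close>, rescaled by a power of \<open>b\<close>, in a window; the windows \<open>1\<close> and
  \<open>J\<close> are too close together for two different powers of \<open>b\<close>.\<close>

lemma (in drifting_windows) scales_arith_progression:
  fixes b c :: nat and p :: int
  assumes "c \<ge> 2" and "b \<ge> 2" and rho: "\<rho> = real c ^ q / real b powi p"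
    and J: "J \<ge> 1" "lo 1 < hi J"
    and mem_1: "M + q \<in> radix_set c b" and mem_J: "M + J * q \<in> radix_set c b"
  obtains K :: int where "\<And>j. j \<le> J \<Longrightarrow> K + int j * p \<ge> 0"
    and "\<And>j. j \<le> J \<Longrightarrow> is_radix_scale c b (M + j * q) (nat (K + int j * p))"
proof -
  have window_iff: "real (M + j * q) * real b powi (K + int j * p) \<le> real c ^ (M + j * q)
        \<and> real c ^ (M + j * q) < (real (M + j * q) + 1) * real b powi (K + int j * p)
      \<longleftrightarrow> real c ^ M / real b powi K \<in> {lo j..<hi j}" for K j
    unfolding lo_def hi_def using assms(1,2) by (intro scale_ineqs_iff_window rho) auto
  have window_if_mem: "\<exists>K. real c ^ M / real b powi K \<in> {lo j..<hi j}"
    if "M + j * q \<in> radix_set c b" for j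
  proof -
    from that obtain k where "is_radix_scale c b (M + j * q) k"
      by (auto simp: radix_set_def)
    then show ?thesis
      using window_iff[of j "int k - int j * p"] by (auto simp: radix_scale_iff_powi)
  qed
  obtain K where K: "real c ^ M / real b powi K \<in> {lo 1..<hi 1}"
    using window_if_mem[of 1] mem_1 by auto
  obtain K' where K': "real c ^ M / real b powi K' \<in> {lo J..<hi J}"
    using window_if_mem[of J] mem_J by auto
  have "K = K'"
    using assms(2)
  proof (rule exponent_unique_if_ratio_less_2[where l = "lo J"])
    show "lo J \<le> real c ^ M / real b powi K" using K lo_le_lo_1[of J] by simp
    show "real c ^ M / real b powi K < 2 * lo J" using K first_last_ratio[OF J] by simp
    show "lo J \<le> real c ^ M / real b powi K'" using K' by simp
    show "real c ^ M / real b powi K' < 2 * lo J"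
      using K' first_last_ratio[OF J] hi_antimono[of 1 J] J by simp
  qed
  then have "real c ^ M / real b powi K \<in> {lo j..<hi j}" if "j \<le> J" for j
    using K K' that by (intro mem_first_last_imp_mem_all) auto
  then have ineqs: "real (M + j * q) * real b powi (K + int j * p) \<le> real c ^ (M + j * q)
      \<and> real c ^ (M + j * q) < (real (M + j * q) + 1) * real b powi (K + int j * p)"
    if "j \<le> J" for j
    using window_iff that by blast
  have nonneg: "K + int j * p \<ge> 0" if "j \<le> J" for j
    using ineqs[OF that] by (intro scale_nonneg[OF assms(1,2), of "M + j * q"]) simp
  show thesis
  proof (rule that)
    show "is_radix_scale c b (M + j * q) (nat (K + int j * p))" if "j \<le> J" for j
      unfolding radix_scale_iff_powi using ineqs[OF that] nonneg[OF that] by simp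
  qed (rule nonneg)
qed

section \<open>Runs of radix numbers\<close>

theorem theorem5p26:
  fixes c b q M :: nat and p :: int
    and \<alpha> \<epsilon> \<rho> x :: real
    and n :: "nat \<Rightarrow> nat" and I :: "nat \<Rightarrow> real set"
  assumes "c \<ge> 2" and "b \<ge> 2"
    and "\<alpha> = log (real b) (real c)"
    and "q \<ge> 1"
    and "\<epsilon> = real q * \<alpha> - of_int p" and "\<epsilon> > 0"
    and "\<rho> = real c ^ q / real b powi p"
    and "x = real q / (\<rho> - 1)"
    and "int M = \<lfloor>x\<rfloor>" and "M \<ge> 1"
    and "\<And>j. n j = M + j * q"
    and "\<And>j. I j = {real (n j) / \<rho> ^ j ..< (real (n j) + 1) / \<rho> ^ j}"
  shows "\<rho> = real b powr \<epsilon> \<and> \<rho> > 1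
    \<and> (\<forall>J\<ge>1.
         (\<rho> ^ (J - 1) * real (M + q) < real (M + J * q + 1) \<longrightarrow>
            (\<Inter>j\<in>{0..J}. I j) = {real (M + q) / \<rho> ..< real (M + J * q + 1) / \<rho> ^ J})
       \<and> (\<rho> ^ (J - 1) * real (M + q) \<ge> real (M + J * q + 1) \<longrightarrow>
            (\<Inter>j\<in>{0..J}. I j) = {}))
    \<and> finite {J. J \<ge> 1 \<and> \<rho> ^ (J - 1) * real (M + q) < real (M + J * q + 1)}
    \<and> {J. J \<ge> 1 \<and> \<rho> ^ (J - 1) * real (M + q) < real (M + J * q + 1)} \<noteq> {}
    \<and> (\<forall>(K::int) (j::nat).
         (real (M + j * q) * real b powi (K + int j * p) \<le> real c ^ (M + j * q)
          \<and> real c ^ (M + j * q) < real (M + j * q + 1) * real b powi (K + int j * p))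
         \<longleftrightarrow> real c ^ M / real b powi K \<in> I j)
    \<and> (\<forall>J. 1 \<le> J
         \<and> J \<le> Max {J. J \<ge> 1 \<and> \<rho> ^ (J - 1) * real (M + q) < real (M + J * q + 1)}
         \<and> M + q \<in> radix_set c b \<and> M + J * q \<in> radix_set c b
         \<longrightarrow> (\<forall>j\<in>{0..J}. M + j * q \<in> radix_set c b)
           \<and> (\<exists>K::int. K \<ge> 0 \<and>
                (\<forall>j\<in>{0..J}. (\<exists>!k. is_radix_scale c b (M + j * q) k)
                   \<and> int (radix_scale c b (M + j * q)) = K + int j * p)))"
proof -
  have b: "real b > 1" and c: "real c > 0" using assms(1,2) by auto
  have rho_powr: "\<rho> = real b powr \<epsilon>"
  proof -
    have "real b powr (real q * \<alpha>) = (real b powr \<alpha>) powr real q"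
      by (simp add: powr_powr mult.commute)
    also have "\<dots> = real c ^ q" using b c assms(3) by (simp add: powr_realpow)
    finally show ?thesis
      using b assms(5,7) by (simp add: powr_diff powr_real_of_int')
  qed
  then have rho: "\<rho> > 1" using b assms(6) by simp
  interpret drifting_windows \<rho> q M
  proof
    have "real M = real_of_int \<lfloor>x\<rfloor>" using assms(9) by (metis of_int_of_nat_eq)
    then have "real M \<le> x" "x < real M + 1" by linarith+
    then show "(\<rho> - 1) * real M \<le> real q" "real q < (\<rho> - 1) * (real M + 1)"
      using rho assms(8) by (simp_all add: field_simps)
  qed (use rho assms(4,10) in auto)
  have I: "I j = {lo j..<hi j}" for j
    by (simp add: assms(11,12) lo_def hi_def)
  let ?S = "{J. J \<ge> 1 \<and> \<rho> ^ (J - 1) * real (M + q) < real (M + J * q + 1)}"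
  have S_eq: "?S = {J. J \<ge> 1 \<and> lo 1 < hi J}" using lo_1_less_hi_iff by blast
  have fin: "finite ?S"
    unfolding S_eq by (rule finite_subset[OF _ finite_lo_1_less_hi]) auto
  have nonempty: "?S \<noteq> {}"
    unfolding S_eq using lo_1_less_hi_1 by auto
  have Inter: "(\<Inter>j\<in>{0..J}. I j) = {lo 1..<hi J}" if "J \<ge> 1" for J
    unfolding I using that by (rule windows_Inter)
  have endpoints: "lo 1 = real (M + q) / \<rho>" "hi J = real (M + J * q + 1) / \<rho> ^ J" for J
    by (simp_all add: lo_def hi_def add_ac)
  have windows: "\<forall>J\<ge>1.
         (\<rho> ^ (J - 1) * real (M + q) < real (M + J * q + 1) \<longrightarrow>
            (\<Inter>j\<in>{0..J}. I j) = {real (M + q) / \<rho> ..< real (M + J * q + 1) / \<rho> ^ J})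
       \<and> (\<rho> ^ (J - 1) * real (M + q) \<ge> real (M + J * q + 1) \<longrightarrow>
            (\<Inter>j\<in>{0..J}. I j) = {})"
  proof (intro allI impI conjI)
    fix J :: nat assume J: "J \<ge> 1"
    show "(\<Inter>j\<in>{0..J}. I j) = {real (M + q) / \<rho> ..< real (M + J * q + 1) / \<rho> ^ J}"
      using Inter[OF J] unfolding endpoints .
    assume "\<rho> ^ (J - 1) * real (M + q) \<ge> real (M + J * q + 1)"
    then have "\<not> lo 1 < hi J" using lo_1_less_hi_iff[OF J] by linarith
    then show "(\<Inter>j\<in>{0..J}. I j) = {}" using Inter[OF J] by simp
  qed
  have equiv: "\<forall>(K::int) (j::nat).
         (real (M + j * q) * real b powi (K + int j * p) \<le> real c ^ (M + j * q)
          \<and> real c ^ (M + j * q) < real (M + j * q + 1) * real b powi (K + int j * p))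
         \<longleftrightarrow> real c ^ M / real b powi K \<in> I j"
  proof (intro allI)
    fix K :: int and j :: nat
    show "(real (M + j * q) * real b powi (K + int j * p) \<le> real c ^ (M + j * q)
          \<and> real c ^ (M + j * q) < real (M + j * q + 1) * real b powi (K + int j * p))
         \<longleftrightarrow> real c ^ M / real b powi K \<in> I j"
      using scale_ineqs_iff_window[OF _ c assms(7), of "real (M + j * q)" K j M] b
      by (simp add: I lo_def hi_def add_ac)
  qed
  have runs: "\<forall>J. 1 \<le> J \<and> J \<le> Max ?S \<and> M + q \<in> radix_set c b \<and> M + J * q \<in> radix_set c b
         \<longrightarrow> (\<forall>j\<in>{0..J}. M + j * q \<in> radix_set c b)
           \<and> (\<exists>K::int. K \<ge> 0 \<and>
                (\<forall>j\<in>{0..J}. (\<exists>!k. is_radix_scale c b (M + j * q) k)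
                   \<and> int (radix_scale c b (M + j * q)) = K + int j * p))"
  proof (intro allI impI)
    fix J
    assume J: "1 \<le> J \<and> J \<le> Max ?S \<and> M + q \<in> radix_set c b \<and> M + J * q \<in> radix_set c b"
    have "Max ?S \<in> ?S" using fin nonempty by (rule Max_in)
    then have "lo 1 < hi (Max ?S)" unfolding S_eq by blast
    then have "lo 1 < hi J" using J hi_antimono[of J "Max ?S"] by linarith
    then obtain K where nonneg: "\<And>j. j \<le> J \<Longrightarrow> K + int j * p \<ge> 0"
      and scale: "\<And>j. j \<le> J \<Longrightarrow> is_radix_scale c b (M + j * q) (nat (K + int j * p))"
      using scales_arith_progression[OF assms(1,2,7)] J by blast
    have mem: "M + j * q \<in> radix_set c b" if "j \<le> J" for j
      using scale[OF that] assms(10) by (auto simp: radix_set_def)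
    have unique: "\<exists>!k. is_radix_scale c b (M + j * q) k" if "j \<le> J" for j
      using ex1_radix_scale[OF assms(2) mem[OF that]] .
    have "radix_scale c b (M + j * q) = nat (K + int j * p)" if "j \<le> J" for j
      using unique[OF that] scale[OF that] is_radix_scale_radix_scale[OF assms(2) mem[OF that]]
      by blast
    then have "int (radix_scale c b (M + j * q)) = K + int j * p" if "j \<le> J" for j
      using that nonneg by simp
    moreover have "K \<ge> 0" using nonneg[of 0] by simp
    ultimately show "(\<forall>j\<in>{0..J}. M + j * q \<in> radix_set c b)
           \<and> (\<exists>K::int. K \<ge> 0 \<and>
                (\<forall>j\<in>{0..J}. (\<exists>!k. is_radix_scale c b (M + j * q) k)
                   \<and> int (radix_scale c b (M + j * q)) = K + int j * p))"
      using mem unique by (intro conjI exI[of _ K]) auto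
  qed
  show ?thesis
    by (intro conjI rho_powr rho windows fin nonempty equiv runs)
qed

end
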